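(* Let $K\subset\mathbb{R}^n$ be a convex body. Every $b$-maximal ellipse $\mathcal{E}$ for $K$ is also an $a$-maximal ellipse for $K$.
   Context: A convex body $K\subset\mathbb{R}^n$ is a compact convex set with non-empty interior in $\mathbb{R}^n$; $K^o$ denotes its interior relative to $\mathbb{R}^n$. Ellipses may be degenerate (line segments). $b$-maximal ellipses. Let $x\in K^o$ and $y\in\mathbb{R}^n\setminus\{0\}$. Consider all ellipses $\mathcal{E}=\mathcal{E}_b(x,y)$ contained in $K$, passing through $x$ with tangent direction $y$ at $x$, i.e. curves parametrized by $$r(\theta)=a\cos\theta+by\sin\theta+(x-a),\qquad \theta\in[0,2\pi],$$ with $a\in\mathbb{R}^n$, $b>0$ such that $r(\theta)\in K$ for all $\theta$. Such an ellipse is called $b$-maximal for $x,y$ if its $b$ is the largest possible among all such ellipses (with $x,y$ fixed, and $a,b$ varying). An ellipse is $b$-maximal if it is $b$-maximal for some $x\in K^o$ and $y\in\mathbb{R}^n\setminus\{0\}$. $a$-maximal ellipses. For $C\in\mathbb{C}^n\setminus\{0\}$, $A\in\mathbb{R}^n$ and $\rho>0$, let $f(\zeta)=\rho\frac{C}{\zeta}+A+\rho\bar C\zeta$. The image $f(\{|\zeta|=1\})=\{A+2\rho\,\mathrm{Re}(\bar C\zeta):|\zeta|=1\}\subset\mathbb{R}^n$ is an ellipse with center $A$; fixing $C$ amounts to fixing the orientation and eccentricity of the ellipse. An ellipse $\mathcal{E}=\{A+2\rho\,\mathrm{Re}(\bar C\zeta):|\zeta|=1\}\subset K$ is called $a$-maximal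 for $K$ (a maximal area ellipse) if $\rho'\le\rho$ whenever $A'\in\mathbb{R}^n$, $\rho'>0$ and $\{A'+2\rho'\,\mathrm{Re}(\bar C\zeta):|\zeta|=1\}\subset K$. *)

theory Defs
  imports "HOL-Analysis.Analysis"
begin

definition convex_body :: "(real ^ 'n) set \<Rightarrow> bool" where
  "convex_body K \<longleftrightarrow> compact K \<and> convex K \<and> interior K \<noteq> {}"

text \<open>
  The curve with parameters \<open>a\<close>, \<open>b\<close> passes through \<open>x\<close> at \<open>\<theta> = 0\<close>, with derivative \<open>b y\<close>
  there. It is a line segment, traversed back and forth, when \<open>a\<close> and \<open>y\<close> are linearly dependent;
  in particular \<open>a = 0\<close> is allowed. Ellipses are point sets throughout, never solid.
\<close>

definition b_ellipse :: "real ^ 'n \<Rightarrow> real \<Rightarrow> real ^ 'n \<Rightarrow> real ^ 'n \<Rightarrow> (real ^ 'n) set" where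
  "b_ellipse a b x y =
     (\<lambda>\<theta>. cos \<theta> *\<^sub>R a + (b * sin \<theta>) *\<^sub>R y + (x - a)) ` {0..2 * pi}"

definition b_maximal_for ::
    "(real ^ 'n) set \<Rightarrow> real ^ 'n \<Rightarrow> real ^ 'n \<Rightarrow> (real ^ 'n) set \<Rightarrow> bool" where
  "b_maximal_for K x y E \<longleftrightarrow>
     (\<exists>a b. b > 0 \<and> E = b_ellipse a b x y \<and> E \<subseteq> K \<and>
        (\<forall>a' b'. b' > 0 \<and> b_ellipse a' b' x y \<subseteq> K \<longrightarrow> b' \<le> b))"

definition b_maximal :: "(real ^ 'n) set \<Rightarrow> (real ^ 'n) set \<Rightarrow> bool" where
  "b_maximal K E \<longleftrightarrow> (\<exists>x y. x \<in> interior K \<and> y \<noteq> 0 \<and> b_maximal_for K x y E)"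

text \<open>
  On the unit circle \<open>1 / \<zeta> = cnj \<zeta>\<close>, so \<open>\<rho> C / \<zeta> + A + \<rho> (cnj C) \<zeta>\<close> is the real vector
  \<open>A + 2 \<rho> Re ((cnj C) \<zeta>)\<close>, with \<open>cnj\<close> and \<open>Re\<close> taken componentwise.
\<close>

definition a_ellipse :: "complex ^ 'n \<Rightarrow> real ^ 'n \<Rightarrow> real \<Rightarrow> (real ^ 'n) set" where
  "a_ellipse C A \<rho> =
     {A + (2 * \<rho>) *\<^sub>R (\<chi> i. Re (cnj (C $ i) * \<zeta>)) | \<zeta>. cmod \<zeta> = 1}"

definition a_maximal :: "(real ^ 'n) set \<Rightarrow> (real ^ 'n) set \<Rightarrow> bool" where
  "a_maximal K E \<longleftrightarrow>
     (\<exists>C A \<rho>. C \<noteq> 0 \<and> \<rho> > 0 \<and> E = a_ellipse C A \<rho> \<and> E \<subseteq> K \<and>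
        (\<forall>A' \<rho>'. \<rho>' > 0 \<and> a_ellipse C A' \<rho>' \<subseteq> K \<longrightarrow> \<rho>' \<le> \<rho>))"

end

theory Submission
  imports Defs
begin

text \<open>
  Let \<open>r \<theta> = cos \<theta> *\<^sub>R a + (b * sin \<theta>) *\<^sub>R y + (x - a)\<close> be a \<open>b\<close>-maximal ellipse for \<open>x\<close>, \<open>y\<close>,
  and suppose that \<open>K\<close> contains a copy of it that is larger by a factor \<open>s > 1\<close>. The homothety
  with centre \<open>x\<close> and ratio \<open>1 / s\<close> maps this copy to a translate \<open>r + d\<close>, which lies in the
  interior of \<open>K\<close> because \<open>x\<close> does. By convexity \<open>r \<theta> + ((1 - cos \<theta>) / 2) *\<^sub>R d\<close> is
  interior too, also at \<open>\<theta> = 0\<close>, where it is \<open>x\<close>. This is again an ellipse through \<open>x\<close> with the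
  same \<open>b\<close> and \<open>y\<close>, now with \<open>a - d / 2\<close> in place of \<open>a\<close>. By compactness \<open>b\<close> can be increased,
  a contradiction.
\<close>

lemma b_ellipse_enlarge:
  fixes a x y :: "real ^ 'n"
  assumes y: "y \<noteq> 0" and sub: "b_ellipse a b x y \<subseteq> interior K"
  obtains b' where "b' > b" "b_ellipse a b' x y \<subseteq> K"
proof -
  have "compact (b_ellipse a b x y)"
    unfolding b_ellipse_def by (intro compact_continuous_image continuous_intros) auto
  then obtain e where e: "e > 0" "(\<Union>p\<in>b_ellipse a b x y. cball p e) \<subseteq> interior K"
    using compact_subset_open_imp_cball_epsilon_subset[OF _ open_interior sub] by blast
  \<comment> \<open>With this \<open>h\<close>, the shift \<open>(h * sin t) *\<^sub>R y\<close> has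
    length at most \<open>e\<close>.\<close>
  define h where "h = e / norm y"
  have "cos t *\<^sub>R a + ((b + h) * sin t) *\<^sub>R y + (x - a) \<in> K" if t: "t \<in> {0..2 * pi}" for t
  proof -
    have "dist (cos t *\<^sub>R a + (b * sin t) *\<^sub>R y + (x - a))
        (cos t *\<^sub>R a + ((b + h) * sin t) *\<^sub>R y + (x - a)) = norm ((h * sin t) *\<^sub>R y)"
      by (simp add: dist_norm algebra_simps norm_minus_commute)
    also have "\<dots> = e * \<bar>sin t\<bar>"
      using y e(1) by (simp add: h_def abs_mult)
    also have "\<dots> \<le> e"
      using e(1) by (simp add: mult_left_le)
    finally have "cos t *\<^sub>R a + ((b + h) * sin t) *\<^sub>R y + (x - a) \<in>
        (\<Union>p\<in>b_ellipse a b x y. cball p e)"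
      using t unfolding b_ellipse_def by (blast intro: mem_cball[THEN iffD2])
    then show ?thesis
      using e(2) interior_subset by blast
  qed
  then have "b_ellipse a (b + h) x y \<subseteq> K"
    unfolding b_ellipse_def by auto
  moreover have "b + h > b"
    using e(1) y by (simp add: h_def)
  ultimately show thesis
    using that by blast
qed

lemma b_ellipse_into_interior:
  fixes a x y A :: "real ^ 'n"
  assumes K: "convex K" and x: "x \<in> interior K" and s: "s > 1"
    and E: "b_ellipse a b x y \<subseteq> K"
    and big: "\<And>t. t \<in> {0..2 * pi} \<Longrightarrow> A + s *\<^sub>R (cos t *\<^sub>R a + (b * sin t) *\<^sub>R y) \<in> K"
  obtains a' where "b_ellipse a' b x y \<subseteq> interior K"
proof -
  \<comment> \<open>Centre \<open>x + (1 / s) *\<^sub>R (A - x)\<close> of the shrunken copy minus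
    the centre \<open>x - a\<close> of the given ellipse.\<close>
  define d where "d = a + (1 / s) *\<^sub>R (A - x)"
  have "cos t *\<^sub>R (a - (1/2) *\<^sub>R d) + (b * sin t) *\<^sub>R y + (x - (a - (1/2) *\<^sub>R d)) \<in> interior K"
    if t: "t \<in> {0..2 * pi}" for t
  proof (cases "cos t = 1")
    \<comment> \<open>The weight \<tau> used below vanishes here, so shrinking gives nothing; but
      the point is \<open>x\<close> itself.\<close>
    case True
    then have "sin t = 0"
      using sin_cos_squared_add[of t] by simp
    with True x show ?thesis
      by simp
  next
    case False
    \<comment> \<open>Being affine in \<open>cos t\<close>, this weight changes only the cosine
      coefficient and the centre, so the curve stays an ellipse with the same sine term.\<close>
    define \<tau> where "\<tau> = (1 - cos t) / 2"
    have \<tau>: "0 < \<tau>" "\<tau> \<le> 1"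
      using False cos_le_one[of t] cos_ge_minus_one[of t] by (auto simp: \<tau>_def less_le)
    define r where "r = cos t *\<^sub>R a + (b * sin t) *\<^sub>R y + (x - a)"
    define w where "w = A + s *\<^sub>R (cos t *\<^sub>R a + (b * sin t) *\<^sub>R y)"
    have "w - (1 - 1 / s) *\<^sub>R (w - x) \<in> interior K"
      using s by (intro mem_interior_convex_shrink[OF K x] big[OF t, folded w_def]) auto
    also have "w - (1 - 1 / s) *\<^sub>R (w - x) = r + d"
      using s unfolding w_def r_def d_def by (simp add: algebra_simps)
    finally have "r + d \<in> interior K" .
    moreover have "r \<in> K"
      using E t by (auto simp: b_ellipse_def r_def)
    ultimately have "r - \<tau> *\<^sub>R (r - (r + d)) \<in> interior K"
      using \<tau> by (intro mem_interior_convex_shrink[OF K])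
    also have "r - \<tau> *\<^sub>R (r - (r + d)) =
        cos t *\<^sub>R (a - (1/2) *\<^sub>R d) + (b * sin t) *\<^sub>R y + (x - (a - (1/2) *\<^sub>R d))"
      unfolding r_def \<tau>_def
      by (simp add: vec_eq_iff field_simps)
    finally show ?thesis .
  qed
  then show thesis
    using that[of "a - (1/2) *\<^sub>R d"] unfolding b_ellipse_def by blast
qed

text \<open>\<open>Re (cnj c * cis t) = Re c * cos t + Im c * sin t\<close>, and the halves cancel
  the factor 2: real and imaginary parts of \<open>C\<close> encode conjugate semidiameters.\<close>

lemma a_ellipse_eq_trig:
  fixes u v A :: "real ^ 'n"
  shows "a_ellipse (\<chi> i. Complex (u $ i / 2) (v $ i / 2)) A \<rho> =
    (\<lambda>t. A + \<rho> *\<^sub>R (cos t *\<^sub>R u + sin t *\<^sub>R v)) ` {0..2 * pi}"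
proof -
  have circle: "{\<zeta>. cmod \<zeta> = 1} = cis ` {0..2 * pi}"
  proof (intro equalityI subsetI)
    fix z assume "z \<in> {\<zeta>. cmod \<zeta> = 1}"
    then have "(Re z)\<^sup>2 + (Im z)\<^sup>2 = 1"
      by (simp add: cmod_power2 [symmetric])
    then obtain t where "0 \<le> t" "t \<le> 2 * pi" "Re z = cos t" "Im z = sin t"
      using sincos_total_2pi_le by blast
    then show "z \<in> cis ` {0..2 * pi}"
      by (intro image_eqI[of _ _ t]) (auto simp: complex_eq_iff)
  qed auto
  have point: "A + (2 * \<rho>) *\<^sub>R (\<chi> i. Re (cnj ((\<chi> i. Complex (u $ i / 2) (v $ i / 2)) $ i) * cis t))
      = A + \<rho> *\<^sub>R (cos t *\<^sub>R u + sin t *\<^sub>R v)" for t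
    by (simp add: vec_eq_iff field_simps)
  have "a_ellipse (\<chi> i. Complex (u $ i / 2) (v $ i / 2)) A \<rho> =
      (\<lambda>\<zeta>. A + (2 * \<rho>) *\<^sub>R (\<chi> i. Re (cnj ((\<chi> i. Complex (u $ i / 2) (v $ i / 2)) $ i) * \<zeta>)))
        ` {\<zeta>. cmod \<zeta> = 1}"
    unfolding a_ellipse_def by (rule setcompr_eq_image)
  then show ?thesis
    unfolding circle image_image point .
qed

theorem proposition3p2:
  fixes K E :: "(real ^ 'n) set"
  assumes "convex_body K"
    and "b_maximal K E"
  shows "a_maximal K E"
proof -
  obtain x y a b where x: "x \<in> interior K" and y: "y \<noteq> 0" and b: "b > 0"
    and E: "E = b_ellipse a b x y" "E \<subseteq> K"
    and max: "\<And>a' b'. b' > 0 \<Longrightarrow> b_ellipse a' b' x y \<subseteq> K \<Longrightarrow> b' \<le> b"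
    using assms(2) unfolding b_maximal_def b_maximal_for_def by blast
  have K: "convex K"
    using assms(1) by (simp add: convex_body_def)
  \<comment> \<open>The semidiameters of \<open>E\<close> are \<open>a\<close> and
    \<open>b *\<^sub>R y\<close>, so \<open>E\<close> has \<rho> = 1.\<close>
  define C where "C = (\<chi> i. Complex (a $ i / 2) ((b *\<^sub>R y) $ i / 2))"
  have ellipse: "a_ellipse C A \<rho> =
      (\<lambda>t. A + \<rho> *\<^sub>R (cos t *\<^sub>R a + (b * sin t) *\<^sub>R y)) ` {0..2 * pi}" for A \<rho>
    unfolding C_def a_ellipse_eq_trig by (simp add: mult.commute)
  \<comment> \<open>The imaginary part keeps \<open>C\<close> nonzero even if
    \<open>a = 0\<close>.\<close>
  obtain i where "y $ i \<noteq> 0"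
    using y by (auto simp: vec_eq_iff)
  then have "C $ i \<noteq> 0"
    using b by (simp add: C_def complex_eq_iff)
  then have C: "C \<noteq> 0"
    by auto
  have "E = a_ellipse C (x - a) 1"
    unfolding E b_ellipse_def ellipse by (simp add: algebra_simps)
  moreover have "s \<le> 1" if sub: "a_ellipse C A s \<subseteq> K" for A s
  proof (rule ccontr)
    assume "\<not> s \<le> 1"
    moreover have "A + s *\<^sub>R (cos t *\<^sub>R a + (b * sin t) *\<^sub>R y) \<in> K" if "t \<in> {0..2 * pi}" for t
      using sub that unfolding ellipse by blast
    ultimately obtain a' where "b_ellipse a' b x y \<subseteq> interior K"
      using b_ellipse_into_interior[OF K x, of s a b y A] E by (metis not_le)
    then obtain b' where "b' > b" "b_ellipse a' b' x y \<subseteq> K"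
      using b_ellipse_enlarge[OF y] by blast
    then show False
      using max[of b' a'] b by auto
  qed
  ultimately show ?thesis
    unfolding a_maximal_def using C E(2)
    by (intro exI[of _ C] exI[of _ "x - a"] exI[of _ "1::real"]) auto
qed

end
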